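(* Let $X$ be a complex reflexive Banach space of dimension larger than $1$ and let $T : X \to X$ be a compact linear operator. Then $T$ has a non-trivial invariant subspace, i.e. there exists a closed linear subspace $Y$ of $X$ with $\{0\}\subsetneq Y\subsetneq X$ and $T(Y)\subseteq Y$. *)

theory Defs
  imports "HOL-Analysis.Analysis"
begin

section \<open>Complex normed spaces and complex Banach spaces\<close>

text \<open>A complex normed space is a real normed space with a complex scalar multiplication that
  extends the real one and for which the norm is absolutely homogeneous. Topology, boundedness
  and completeness are those of the underlying real normed space.\<close>

class complex_normed_vector = real_normed_vector +
  fixes scaleC :: "complex \<Rightarrow> 'a \<Rightarrow> 'a" (infixr "*\<^sub>C" 75)
  assumes scaleC_add_right: "c *\<^sub>C (x + y) = c *\<^sub>C x + c *\<^sub>C y"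
    and scaleC_add_left: "(c + d) *\<^sub>C x = c *\<^sub>C x + d *\<^sub>C x"
    and scaleC_scaleC: "c *\<^sub>C (d *\<^sub>C x) = (c * d) *\<^sub>C x"
    and scaleC_of_real: "complex_of_real r *\<^sub>C x = r *\<^sub>R x"
    and norm_scaleC: "norm (c *\<^sub>C x) = cmod c * norm x"

class complex_banach = complex_normed_vector + banach

lemma scaleC_one: "1 *\<^sub>C x = (x::'a::complex_normed_vector)"
  using scaleC_of_real[of 1 x] by simp

global_interpretation complex_vector: vector_space
  "scaleC :: complex \<Rightarrow> 'a \<Rightarrow> 'a::complex_normed_vector"
  by unfold_locales
    (simp_all add: scaleC_add_right scaleC_add_left scaleC_scaleC scaleC_one)

instantiation complex :: complex_banach
begin
definition scaleC_complex :: "complex \<Rightarrow> complex \<Rightarrow> complex"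
  where "scaleC_complex c x = c * x"
instance
  by standard (simp_all add: scaleC_complex_def algebra_simps norm_mult scaleR_conv_of_real)
end

text \<open>A basis is an arbitrary (possibly infinite) Hamel basis over the complex numbers; the
  library's \<open>dim\<close> is not used since it is 0 for infinite-dimensional spaces.\<close>

definition complex_dim_gt_1 :: "'a::complex_normed_vector itself \<Rightarrow> bool"
  where "complex_dim_gt_1 _ \<longleftrightarrow>
    (\<exists>B::'a set. complex_vector.independent B \<and> complex_vector.span B = UNIV \<and>
       (infinite B \<or> card B > 1))"


section \<open>Dual, bidual and reflexivity\<close>

text \<open>The topological dual: bounded complex-linear functionals, with the operator norm inherited
  from the library type of bounded real-linear maps.\<close>

typedef (overloaded) 'a cdual =
  "{f :: 'a::complex_normed_vector \<Rightarrow>\<^sub>L complex.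
      \<forall>c x. blinfun_apply f (c *\<^sub>C x) = c * blinfun_apply f x}"
  by (rule exI[of _ 0]) simp

setup_lifting type_definition_cdual

lift_definition cdual_apply :: "'a::complex_normed_vector cdual \<Rightarrow> 'a \<Rightarrow> complex"
  is blinfun_apply .

lemma bounded_linear_const_mult_blinfun:
  "bounded_linear (\<lambda>x. c * blinfun_apply f x)" for c :: complex
  by (intro bounded_linear_const_mult blinfun.bounded_linear_right)

instantiation cdual :: (complex_normed_vector) complex_normed_vector
begin

lift_definition zero_cdual :: "'a cdual" is 0 by simp
lift_definition plus_cdual :: "'a cdual \<Rightarrow> 'a cdual \<Rightarrow> 'a cdual" is "(+)"
  by (simp add: blinfun.add_left algebra_simps)
lift_definition minus_cdual :: "'a cdual \<Rightarrow> 'a cdual \<Rightarrow> 'a cdual" is "(-)"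
  by (simp add: blinfun.diff_left algebra_simps)
lift_definition uminus_cdual :: "'a cdual \<Rightarrow> 'a cdual" is uminus
  by (simp add: blinfun.minus_left)
lift_definition scaleR_cdual :: "real \<Rightarrow> 'a cdual \<Rightarrow> 'a cdual" is scaleR
  by (simp add: blinfun.scaleR_left)
lift_definition scaleC_cdual :: "complex \<Rightarrow> 'a cdual \<Rightarrow> 'a cdual"
  is "\<lambda>c f. Blinfun (\<lambda>x. c * blinfun_apply f x)"
  by (simp add: bounded_linear_Blinfun_apply bounded_linear_const_mult_blinfun)
lift_definition norm_cdual :: "'a cdual \<Rightarrow> real" is norm .
lift_definition dist_cdual :: "'a cdual \<Rightarrow> 'a cdual \<Rightarrow> real" is dist .
lift_definition sgn_cdual :: "'a cdual \<Rightarrow> 'a cdual" is sgn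
  by (simp add: sgn_div_norm blinfun.scaleR_left)
definition uniformity_cdual :: "('a cdual \<times> 'a cdual) filter"
  where "uniformity_cdual = (INF e\<in>{0<..}. principal {(x, y). dist x y < e})"
definition open_cdual :: "'a cdual set \<Rightarrow> bool"
  where "open_cdual U \<longleftrightarrow>
    (\<forall>x\<in>U. eventually (\<lambda>(x', y). x' = x \<longrightarrow> y \<in> U) uniformity)"

lemma norm_Blinfun_const_mult:
  "norm (Blinfun (\<lambda>x. c * blinfun_apply f x)) = cmod c * norm f"
  for f :: "'b::real_normed_vector \<Rightarrow>\<^sub>L complex"
proof -
  have le: "norm (Blinfun (\<lambda>x. c * blinfun_apply g x)) \<le> cmod c * norm g"
    for c and g :: "'b \<Rightarrow>\<^sub>L complex"
  proof (rule norm_blinfun_bound)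
    show "norm (blinfun_apply (Blinfun (\<lambda>x. c * blinfun_apply g x)) x)
        \<le> cmod c * norm g * norm x" for x
      using mult_left_mono[OF norm_blinfun[of g x], of "cmod c"]
      by (simp add: bounded_linear_Blinfun_apply bounded_linear_const_mult_blinfun
          norm_mult mult.assoc)
  qed simp
  show ?thesis
  proof (cases "c = 0")
    case True
    then show ?thesis
      using le[of 0 f] by simp
  next
    case False
    let ?g = "Blinfun (\<lambda>x. c * blinfun_apply f x)"
    have "Blinfun (\<lambda>x. inverse c * blinfun_apply ?g x) = f"
      using False
      by (simp add: bounded_linear_Blinfun_apply bounded_linear_const_mult_blinfun
          mult.assoc[symmetric] blinfun_apply_inverse)
    then have "norm f \<le> cmod (inverse c) * norm ?g"
      using le[of "inverse c" ?g] by simp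
    then have "cmod c * norm f \<le> norm ?g"
      using False by (simp add: norm_inverse norm_divide field_simps)
    with le[of c f] show ?thesis by simp
  qed
qed

instance
proof
  fix x y z :: "'a cdual" and a b :: real and c d :: complex
  show "x + y + z = x + (y + z)" by transfer simp
  show "x + y = y + x" by transfer simp
  show "0 + x = x" by transfer simp
  show "- x + x = 0" by transfer simp
  show "x - y = x + - y" by transfer simp
  show "a *\<^sub>R (x + y) = a *\<^sub>R x + a *\<^sub>R y" by transfer (simp add: scaleR_add_right)
  show "(a + b) *\<^sub>R x = a *\<^sub>R x + b *\<^sub>R x" by transfer (simp add: scaleR_add_left)
  show "a *\<^sub>R b *\<^sub>R x = (a * b) *\<^sub>R x" by transfer simp
  show "1 *\<^sub>R x = x" by transfer simp
  show "dist x y = norm (x - y)" by transfer (simp add: dist_norm)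
  show "sgn x = inverse (norm x) *\<^sub>R x" by transfer (simp add: sgn_div_norm)
  show "(uniformity :: ('a cdual \<times> 'a cdual) filter)
      = (INF e\<in>{0<..}. principal {(x, y). dist x y < e})"
    by (rule uniformity_cdual_def)
  show "open U \<longleftrightarrow> (\<forall>x\<in>U. eventually (\<lambda>(x', y). x' = x \<longrightarrow> y \<in> U) uniformity)"
    for U :: "'a cdual set"
    by (rule open_cdual_def)
  show "norm x = 0 \<longleftrightarrow> x = 0" by transfer simp
  show "norm (x + y) \<le> norm x + norm y" by transfer (rule norm_triangle_ineq)
  show "norm (a *\<^sub>R x) = \<bar>a\<bar> * norm x" by transfer simp
  note [simp] = bounded_linear_Blinfun_apply bounded_linear_const_mult bounded_linear_add
    blinfun.bounded_linear_right
  show "c *\<^sub>C (x + y) = c *\<^sub>C x + c *\<^sub>C y"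
    by transfer (auto intro!: blinfun_eqI simp: blinfun.add_left algebra_simps)
  show "(c + d) *\<^sub>C x = c *\<^sub>C x + d *\<^sub>C x"
    by transfer (auto intro!: blinfun_eqI simp: blinfun.add_left algebra_simps)
  show "c *\<^sub>C (d *\<^sub>C x) = (c * d) *\<^sub>C x"
    by transfer (auto intro!: blinfun_eqI simp: algebra_simps)
  show "complex_of_real a *\<^sub>C x = a *\<^sub>R x"
    by transfer (auto intro!: blinfun_eqI simp: blinfun.scaleR_left scaleR_conv_of_real)
  show "norm (c *\<^sub>C x) = cmod c * norm x"
    by transfer (rule norm_Blinfun_const_mult)
qed

end

lemma bounded_linear_cdual_eval: "bounded_linear (\<lambda>f. cdual_apply f x)"
proof (rule bounded_linear_intro[where K = "norm x"])
  show "cdual_apply (f + g) x = cdual_apply f x + cdual_apply g x" for f g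
    by transfer (simp add: blinfun.add_left)
  show "cdual_apply (r *\<^sub>R f) x = r *\<^sub>R cdual_apply f x" for r f
    by transfer (simp add: blinfun.scaleR_left)
  show "norm (cdual_apply f x) \<le> norm f * norm x" for f
    by transfer (rule norm_blinfun)
qed

lemma cdual_apply_scaleC: "cdual_apply (c *\<^sub>C f) x = c * cdual_apply f x"
  by transfer (simp add: bounded_linear_Blinfun_apply bounded_linear_const_mult_blinfun)

lift_definition bidual_embedding :: "'a::complex_normed_vector \<Rightarrow> 'a cdual cdual"
  is "\<lambda>x. Blinfun (\<lambda>f. cdual_apply f x)"
  by (simp add: bounded_linear_Blinfun_apply bounded_linear_cdual_eval cdual_apply_scaleC)

lemma bidual_embedding_apply: "cdual_apply (bidual_embedding x) f = cdual_apply f x"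
  by (simp add: cdual_apply.rep_eq[of "bidual_embedding x"] bidual_embedding.rep_eq
      bounded_linear_Blinfun_apply bounded_linear_cdual_eval)

definition reflexive_space :: "'a::complex_normed_vector itself \<Rightarrow> bool"
  where "reflexive_space _ \<longleftrightarrow> surj (bidual_embedding :: 'a \<Rightarrow> 'a cdual cdual)"


section \<open>Compact operators\<close>

definition compact_operator ::
  "('a::complex_normed_vector \<Rightarrow> 'b::complex_normed_vector) \<Rightarrow> bool"
  where "compact_operator T \<longleftrightarrow>
    Vector_Spaces.linear scaleC scaleC T \<and>
    (\<forall>S. bounded S \<longrightarrow> compact (closure (T ` S)))"

end

theory Submission
  imports Defs "HOL-Computational_Algebra.Polynomial"
begin

text \<open>
  The invariant subspace comes from Lomonosov's argument, in the form due to Hilden that avoids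
  Schauder's fixed point theorem. An eigenvector spans an invariant line, so let \<open>T\<close> have no
  eigenvector, and suppose that it has no non-trivial closed invariant subspace. Then the vectors
  \<open>p(T) y\<close>, with \<open>p\<close> a polynomial, are dense for every \<open>y \<noteq> 0\<close> (\<open>dense_orbit\<close>). Choose a ball
  \<open>B\<close> with \<open>0\<close> neither in \<open>B\<close> nor in the compact set \<open>closure (T ` B)\<close>. By compactness, finitely
  many polynomials suffice to bring every point of \<open>T ` B\<close> back into \<open>B\<close>
  (\<open>compact_operator_finite_return\<close>). Starting at the centre of \<open>B\<close> and alternating \<open>T\<close> with these
  polynomials, which commute with \<open>T\<close>, gives vectors \<open>T\<^sup>n v\<^sub>n\<close> in \<open>B\<close> where the norm of \<open>v\<^sub>n\<close>
  grows at most like \<open>C\<^sup>n\<close> (\<open>iterated_return\<close>). This contradicts \<open>0 \<notin> B\<close> as soon as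
  \<open>C\<^sup>n \<parallel>T\<^sup>n\<parallel>\<close> tends to \<open>0\<close>.

  What remains is that a compact operator without eigenvectors is quasinilpotent. This is usually
  read off from the spectral theory of compact operators and the spectral radius formula. There is
  a shorter way. Compactness gives a constant \<open>M\<close> with \<open>\<parallel>x\<parallel> \<le> M \<parallel>x - z T x\<parallel>\<close> for all \<open>x\<close> and all
  complex \<open>z\<close> in the disc of radius \<open>\<rho>\<close> (\<open>uniform_lower_bound\<close>). For an \<open>N\<close>-th root of unity
  \<open>w\<close>, the operator \<open>1 - w r T\<close> divides \<open>1 - r\<^sup>N T\<^sup>N\<close>, the quotient being a geometric sum, and a
  weighted sum of the squares of these quotients over all \<open>w\<close> leaves only the power
  \<open>T\<^sup>N\<^sup>-\<^sup>1\<close>, with the large coefficient \<open>N\<^sup>2\<close> (\<open>root_of_unity_filter\<close>). Each quotient is controlled by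
  the lower bound, whence \<open>N r\<^sup>N \<parallel>T\<^sup>N\<parallel> \<le> \<rho> \<parallel>T\<parallel> M\<^sup>2 (1 + r\<^sup>N \<parallel>T\<^sup>N\<parallel>)\<^sup>2\<close> for \<open>0 \<le> r \<le> \<rho>\<close>. For large \<open>N\<close>
  this excludes the value \<open>1\<close> for the quantity \<open>r\<^sup>N \<parallel>T\<^sup>N\<parallel>\<close>. That quantity is continuous in
  \<open>r\<close> and vanishes at \<open>r = 0\<close>, so it stays below \<open>1\<close> up to \<open>r = \<rho>\<close> (\<open>onorm_funpow_small\<close>). All
  estimates are made with polynomials in \<open>T\<close>, so no operator has to be inverted.
\<close>

section \<open>Complex scalar multiplication\<close>

lemma bounded_bilinear_scaleC:
  "bounded_bilinear (scaleC :: complex \<Rightarrow> 'a \<Rightarrow> 'a::complex_normed_vector)"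
proof
  fix r :: real and a a' :: complex and b b' :: 'a
  show "(r *\<^sub>R a) *\<^sub>C b = r *\<^sub>R a *\<^sub>C b"
    unfolding scaleR_conv_of_real[of r a] scaleC_scaleC[symmetric] scaleC_of_real ..
  show "a *\<^sub>C (r *\<^sub>R b) = r *\<^sub>R a *\<^sub>C b"
    unfolding scaleC_of_real[symmetric] scaleC_scaleC by (simp only: mult.commute)
  show "\<exists>K. \<forall>a (b::'a). norm (a *\<^sub>C b) \<le> norm a * norm b * K"
    by (rule exI[of _ 1]) (simp add: norm_scaleC)
qed (simp_all add: scaleC_add_left scaleC_add_right)

lemmas tendsto_scaleC = bounded_bilinear.tendsto[OF bounded_bilinear_scaleC]
lemmas bounded_linear_scaleC_left =
  bounded_bilinear.bounded_linear_left[OF bounded_bilinear_scaleC]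
lemmas bounded_linear_scaleC_right =
  bounded_bilinear.bounded_linear_right[OF bounded_bilinear_scaleC]

text \<open>For \<open>x \<noteq> 0\<close> the line is a rescaled isometric copy of the complex plane, hence complete.\<close>

lemma closed_complex_line:
  fixes x :: "'a::complex_normed_vector"
  shows "closed (range (\<lambda>c. c *\<^sub>C x))"
proof (cases "x = 0")
  case True
  then have "range (\<lambda>c. c *\<^sub>C x) = {0}" by auto
  then show ?thesis by simp
next
  case False
  have "complete (range (\<lambda>c. c *\<^sub>C x))"
  proof (rule complete_isometric_image)
    show "0 < norm x" using False by simp
    show "\<forall>c\<in>UNIV. norm x * norm c \<le> norm (c *\<^sub>C x)"
      by (simp add: norm_scaleC mult.commute)
  qed (simp_all add: bounded_linear_scaleC_left complete_UNIV)
  then show ?thesis by (rule complete_imp_closed)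
qed

lemma complex_line_neq_UNIV:
  assumes "complex_dim_gt_1 TYPE('a::complex_normed_vector)"
  shows "range (\<lambda>c. c *\<^sub>C (x::'a)) \<noteq> UNIV"
proof
  assume "range (\<lambda>c. c *\<^sub>C x) = UNIV"
  then have span: "complex_vector.span {x} = UNIV"
    unfolding complex_vector.span_singleton .
  obtain B :: "'a set" where B: "complex_vector.independent B" "infinite B \<or> card B > 1"
    using assms unfolding complex_dim_gt_1_def by blast
  have "finite B \<and> card B \<le> card {x}"
  proof (rule complex_vector.independent_span_bound)
    show "B \<subseteq> complex_vector.span {x}" unfolding span by (rule subset_UNIV)
  qed (use B in simp_all)
  with B show False by auto
qed


section \<open>Polynomials in an operator\<close>

locale bounded_clinear =
  fixes T :: "'a::complex_normed_vector \<Rightarrow> 'a"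
  assumes clinear: "Vector_Spaces.linear scaleC scaleC T"
    and bounded_linear: "bounded_linear T"
begin

lemma scaleC: "T (c *\<^sub>C x) = c *\<^sub>C T x"
  by (rule module_hom.scale[OF clinear[unfolded Vector_Spaces.linear_iff_module_hom]])

lemmas diff = linear_diff[OF bounded_linear.linear[OF bounded_linear]]
  and zero = linear_0[OF bounded_linear.linear[OF bounded_linear]]

lemma bounded_linear_funpow: "bounded_linear (T ^^ n)"
proof (induction n)
  case (Suc n)
  then show ?case using bounded_linear_compose[OF bounded_linear Suc] by (simp add: o_def)
qed (simp add: bounded_linear_ident id_def)

definition poly_op :: "complex poly \<Rightarrow> 'a \<Rightarrow> 'a"
  where "poly_op p x = (\<Sum>i\<le>degree p. coeff p i *\<^sub>C (T ^^ i) x)"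

text \<open>Allowing any degree bound makes it possible to add polynomials of different degrees.\<close>

lemma poly_op_altdef:
  assumes "degree p \<le> n"
  shows "poly_op p x = (\<Sum>i\<le>n. coeff p i *\<^sub>C (T ^^ i) x)"
  unfolding poly_op_def
  by (rule sum.mono_neutral_left) (use assms in \<open>auto simp: coeff_eq_0\<close>)

lemma poly_op_0 [simp]: "poly_op 0 x = 0"
  by (simp add: poly_op_def)

lemma poly_op_pCons: "poly_op (pCons a p) x = a *\<^sub>C x + T (poly_op p x)"
proof -
  have "poly_op (pCons a p) x = (\<Sum>i\<le>Suc (degree p). coeff (pCons a p) i *\<^sub>C (T ^^ i) x)"
    by (rule poly_op_altdef) (rule degree_pCons_le)
  also have "\<dots> = a *\<^sub>C x + T (poly_op p x)"
    by (subst sum.atMost_Suc_shift)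
      (simp add: poly_op_def linear_sum[OF bounded_linear.linear[OF bounded_linear]] scaleC)
  finally show ?thesis .
qed

lemma poly_op_add: "poly_op (p + q) x = poly_op p x + poly_op q x"
  using poly_op_altdef[of "p + q" "max (degree p) (degree q)"]
    poly_op_altdef[of p "max (degree p) (degree q)"]
    poly_op_altdef[of q "max (degree p) (degree q)"]
  by (simp add: degree_add_le scaleC_add_left sum.distrib)

lemma poly_op_smult: "poly_op (smult c p) x = c *\<^sub>C poly_op p x"
  using poly_op_altdef[of "smult c p" "degree p"]
  by (simp add: poly_op_def degree_smult_le scaleC_scaleC complex_vector.scale_sum_right)

lemma poly_op_diff: "poly_op (p - q) x = poly_op p x - poly_op q x"
  using poly_op_add[of "p - q" q x] by simp

lemma poly_op_sum: "poly_op (\<Sum>i\<in>A. f i) x = (\<Sum>i\<in>A. poly_op (f i) x)"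
  by (induction A rule: infinite_finite_induct) (simp_all add: poly_op_add)

lemma poly_op_1 [simp]: "poly_op 1 x = x"
  using poly_op_pCons[of 1 0 x] by (simp add: one_pCons zero scaleC_one)

text \<open>Evaluation at \<open>T\<close> turns products into compositions; in particular all polynomials in \<open>T\<close>
  commute. Both the growth estimate and Hilden's iteration rest on this.\<close>

lemma poly_op_mult: "poly_op (p * q) x = poly_op p (poly_op q x)"
  by (induction p) (simp_all add: poly_op_pCons poly_op_add poly_op_smult scaleC_one)

lemma poly_op_linear_power: "poly_op ([:0, c:] ^ n) x = c ^ n *\<^sub>C (T ^^ n) x"
  by (induction n)
    (simp_all add: poly_op_mult poly_op_pCons scaleC scaleC_scaleC zero scaleC_one
      mult.commute del: mult_pCons_left)

lemma bounded_linear_poly_op: "bounded_linear (poly_op p)"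
  unfolding poly_op_def[abs_def]
  by (intro bounded_linear_sum bounded_linear_compose[OF bounded_linear_scaleC_right]
      bounded_linear_funpow)

end


section \<open>Growth of the powers of an operator\<close>

lemma sum_smult_left: "(\<Sum>k\<in>A. smult (f k) p) = smult (\<Sum>k\<in>A. f k) p"
  by (induction A rule: infinite_finite_induct) (simp_all add: smult_add_left)

lemma sum_smult_right: "(\<Sum>k\<in>A. smult c (f k)) = smult c (\<Sum>k\<in>A. f k)"
  by (induction A rule: infinite_finite_induct) (simp_all add: smult_add_right)

lemma root_of_unity_power_sum:
  fixes N m :: nat
  assumes "N > 0"
  defines "w \<equiv> exp (2 * of_real pi * \<i> / of_nat N)"
  shows "(\<Sum>k<N. (w ^ m) ^ k) = (if N dvd m then of_nat N else 0)"
proof -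
  have w: "w ^ m = exp (2 * of_real pi * \<i> * of_nat m / of_nat N)"
    unfolding w_def by (simp add: exp_of_nat_mult[symmetric] field_simps)
  have w1: "w ^ m = 1 \<longleftrightarrow> N dvd m"
    unfolding w using complex_root_unity_eq_1[of N m] assms by simp
  have "w ^ N = 1"
    unfolding w_def using assms by (simp add: exp_of_nat_mult[symmetric] exp_two_pi_i')
  then have "(w ^ m) ^ N = 1"
    by (simp add: power_mult[symmetric] mult.commute[of m]) (simp add: power_mult)
  then show ?thesis
    using w1 by (auto simp: sum_gp_strict)
qed

text \<open>For \<open>w\<close> the basic \<open>N\<close>-th root of unity and \<open>G\<^sub>k = (1 - t\<^sup>N) / (1 - w\<^sup>k t)\<close>, this is the identity
  \<open>\<Sum>\<^sub>k w\<^sup>k / (1 - w\<^sup>k t)\<^sup>2 = N\<^sup>2 t\<^sup>N\<^sup>-\<^sup>1 / (1 - t\<^sup>N)\<^sup>2\<close>, the derivative of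
  \<open>\<Sum>\<^sub>k 1 / (1 - w\<^sup>k t) = N / (1 - t\<^sup>N)\<close>, with denominators cleared. Taking squares is essential:
  they give \<open>N\<^sup>2\<close> on the right, one factor \<open>N\<close> more than the number of summands on the left.
  After expanding, the sum over \<open>k\<close> kills every \<open>t\<^sup>i\<^sup>+\<^sup>j\<close> unless \<open>N\<close> divides \<open>i + j + 1\<close>, which for
  \<open>i, j < N\<close> means \<open>i + j + 1 = N\<close>; there are \<open>N\<close> such pairs.\<close>

lemma root_of_unity_filter:
  fixes t :: "complex poly"
  assumes N: "N > 0"
  defines "w \<equiv> exp (2 * of_real pi * \<i> / of_nat N)"
  shows "(\<Sum>k<N. smult (w ^ k) ((\<Sum>i<N. (smult (w ^ k) t) ^ i)\<^sup>2)) = smult ((of_nat N)\<^sup>2) (t ^ (N - 1))"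
proof -
  have "(\<Sum>k<N. smult (w ^ k) ((\<Sum>i<N. (smult (w ^ k) t) ^ i)\<^sup>2))
      = (\<Sum>k<N. \<Sum>i<N. \<Sum>j<N. smult ((w ^ (i + j + 1)) ^ k) (t ^ (i + j)))"
    by (simp add: power2_eq_square sum_product sum_smult_right[symmetric] smult_power
        power_add power_mult[symmetric] power_mult_distrib mult_ac)
  also have "\<dots> = (\<Sum>i<N. \<Sum>j<N. \<Sum>k<N. smult ((w ^ (i + j + 1)) ^ k) (t ^ (i + j)))"
    by (subst sum.swap) (intro sum.cong refl sum.swap)
  also have "\<dots> = (\<Sum>i<N. \<Sum>j<N. smult (if N dvd i + j + 1 then of_nat N else 0) (t ^ (i + j)))"
    unfolding sum_smult_left w_def root_of_unity_power_sum[OF N] ..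
  also have "\<dots> = (\<Sum>i<N. \<Sum>j<N. if j = N - 1 - i then smult (of_nat N) (t ^ (N - 1)) else 0)"
  proof (intro sum.cong refl)
    fix i j assume ij: "i \<in> {..<N}" "j \<in> {..<N}"
    have "N dvd i + j + 1 \<longleftrightarrow> j = N - 1 - i"
    proof
      assume "N dvd i + j + 1"
      then obtain q where q: "i + j + 1 = N * q" by (elim dvdE)
      have "q > 0" using q by (cases q) auto
      moreover have "q < 2"
      proof (rule ccontr)
        assume "\<not> q < 2"
        then have "N * 2 \<le> N * q" by (intro mult_left_mono) auto
        with q ij show False by simp
      qed
      ultimately have "q = 1" by simp
      with q show "j = N - 1 - i" by simp
    qed (use ij in auto)
    then show "smult (if N dvd i + j + 1 then of_nat N else 0) (t ^ (i + j))
        = (if j = N - 1 - i then smult (of_nat N) (t ^ (N - 1)) else 0)"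
      using ij by auto
  qed
  also have "\<dots> = smult ((of_nat N)\<^sup>2) (t ^ (N - 1))"
    using N by (simp add: power2_eq_square of_nat_poly)
  finally show ?thesis .
qed

context bounded_clinear
begin

text \<open>Each \<open>1 - w\<^sup>k r T\<close> is bounded below by \<open>1 / M\<close>, so the quotient of \<open>1 - r\<^sup>N T\<^sup>N\<close> by it is bounded
  by \<open>M \<parallel>1 - r\<^sup>N T\<^sup>N\<parallel>\<close>. The \<open>N\<close> squared quotients combine to \<open>N\<^sup>2 (r T)\<^sup>N\<^sup>-\<^sup>1\<close>.\<close>

lemma power_estimate:
  assumes M: "\<And>z x. cmod z \<le> r \<Longrightarrow> norm x \<le> M * norm (x - z *\<^sub>C T x)"
    and r: "0 \<le> r" and "0 \<le> M" and N: "N > 0"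
  shows "N * (r ^ (N - 1) * norm ((T ^^ (N - 1)) x)) \<le> M\<^sup>2 * (1 + r ^ N * onorm (T ^^ N))\<^sup>2 * norm x"
proof -
  define w where "w = exp (2 * of_real pi * \<i> / of_nat N)"
  define t where "t = [:0, complex_of_real r:]"
  define G where "G k = (\<Sum>i<N. (smult (w ^ k) t) ^ i)" for k
  define y where "y = poly_op ((1 - t ^ N)\<^sup>2) x"
  have norm_w: "cmod w = 1"
    unfolding w_def by simp
  have wN: "w ^ N = 1"
    unfolding w_def using N by (simp add: exp_of_nat_mult[symmetric] exp_two_pi_i')
  have geometric: "(1 - smult (w ^ k) t) * G k = 1 - t ^ N" for k
  proof -
    have "(1 - smult (w ^ k) t) * G k = 1 - (smult (w ^ k) t) ^ N"
      unfolding G_def by (rule one_diff_power_eq[symmetric])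
    also have "(smult (w ^ k) t) ^ N = t ^ N"
      by (simp add: smult_power power_mult[symmetric] mult.commute[of k]) (simp add: power_mult wN)
    finally show ?thesis .
  qed
  have lower: "norm u \<le> M * norm (poly_op (1 - smult (w ^ k) t) u)" for k u
  proof -
    have "poly_op (1 - smult (w ^ k) t) u = u - (w ^ k * r) *\<^sub>C T u"
      by (simp add: t_def poly_op_diff poly_op_smult poly_op_pCons zero scaleC_scaleC scaleC)
    then show ?thesis
      using M[of "w ^ k * r" u] r by (simp add: norm_mult norm_power norm_w)
  qed
  have G: "norm (poly_op ((G k)\<^sup>2) x) \<le> M\<^sup>2 * norm y" for k
  proof -
    let ?D = "1 - smult (w ^ k) t"
    have "norm (poly_op ((G k)\<^sup>2) x) \<le> M * (M * norm (poly_op ?D (poly_op ?D (poly_op ((G k)\<^sup>2) x))))"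
      by (rule order_trans[OF lower mult_left_mono[OF lower \<open>0 \<le> M\<close>]])
    also have "poly_op ?D (poly_op ?D (poly_op ((G k)\<^sup>2) x)) = y"
      unfolding y_def geometric[of k, symmetric] power_mult_distrib
      by (simp add: poly_op_mult power2_eq_square)
    finally show ?thesis by (simp add: power2_eq_square)
  qed
  have "(of_nat N)\<^sup>2 *\<^sub>C (of_real r ^ (N - 1) *\<^sub>C (T ^^ (N - 1)) x)
      = poly_op (\<Sum>k<N. smult (w ^ k) ((G k)\<^sup>2)) x"
    unfolding G_def w_def root_of_unity_filter[OF N]
    by (simp only: poly_op_smult t_def poly_op_linear_power)
  also have "\<dots> = (\<Sum>k<N. w ^ k *\<^sub>C poly_op ((G k)\<^sup>2) x)"
    by (simp add: poly_op_sum poly_op_smult)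
  also have "norm \<dots> \<le> (\<Sum>k<N. M\<^sup>2 * norm y)"
    by (rule sum_norm_le) (simp add: norm_scaleC norm_power norm_w G)
  finally have "real N * (real N * (r ^ (N - 1) * norm ((T ^^ (N - 1)) x))) \<le> real N * (M\<^sup>2 * norm y)"
    using r by (simp add: norm_scaleC norm_power norm_mult power2_eq_square mult_ac)
  then have main: "real N * (r ^ (N - 1) * norm ((T ^^ (N - 1)) x)) \<le> M\<^sup>2 * norm y"
    using N by simp
  let ?c = "1 + r ^ N * onorm (T ^^ N)"
  \<comment> \<open>It remains to bound \<open>y\<close>, which is \<open>1 - r\<^sup>N T\<^sup>N\<close> applied twice to \<open>x\<close>.\<close>
  have c: "norm (poly_op (1 - t ^ N) u) \<le> ?c * norm u" for u
  proof -
    have "norm (poly_op (1 - t ^ N) u) = norm (u - of_real r ^ N *\<^sub>C (T ^^ N) u)"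
      by (simp only: t_def poly_op_diff poly_op_linear_power poly_op_1)
    also have "\<dots> \<le> norm u + r ^ N * norm ((T ^^ N) u)"
      using norm_triangle_ineq4[of u "of_real r ^ N *\<^sub>C (T ^^ N) u"] r
      by (simp add: norm_scaleC norm_power)
    also have "\<dots> \<le> norm u + r ^ N * (onorm (T ^^ N) * norm u)"
      using r by (intro add_left_mono mult_left_mono onorm bounded_linear_funpow) auto
    finally show ?thesis by (simp add: algebra_simps)
  qed
  have c0: "0 \<le> ?c"
    using r onorm_pos_le[OF bounded_linear_funpow, of N] by simp
  have "norm y \<le> ?c * norm (poly_op (1 - t ^ N) x)"
    unfolding y_def power2_eq_square poly_op_mult by (rule c)
  also have "\<dots> \<le> ?c * (?c * norm x)"
    by (intro mult_left_mono c c0)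
  finally have "M\<^sup>2 * norm y \<le> M\<^sup>2 * (?c * (?c * norm x))"
    by (intro mult_left_mono) auto
  with main show ?thesis by (simp add: power2_eq_square mult_ac)
qed

text \<open>If \<open>r\<^sup>N \<parallel>T\<^sup>N\<parallel>\<close> reached \<open>1\<close> for some \<open>r \<le> \<rho>\<close>, the previous estimate would bound \<open>N\<close>
  by \<open>\<rho> \<parallel>T\<parallel> M\<^sup>2 (1 + 1)\<^sup>2\<close>, the threshold in the hypothesis. The lower bound is needed on the whole
  disc: the argument moves \<open>r\<close> from \<open>0\<close>, where the quantity vanishes, up to \<open>\<rho>\<close>.\<close>

lemma onorm_funpow_small:
  assumes M: "\<And>z x. cmod z \<le> \<rho> \<Longrightarrow> norm x \<le> M * norm (x - z *\<^sub>C T x)"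
    and "0 \<le> \<rho>" and "0 \<le> M" and N: "real N > 4 * \<rho> * onorm T * M\<^sup>2"
  shows "\<rho> ^ N * onorm (T ^^ N) < 1"
proof (rule ccontr)
  assume "\<not> \<rho> ^ N * onorm (T ^^ N) < 1"
  have "0 \<le> 4 * \<rho> * onorm T * M\<^sup>2"
    using onorm_pos_le[OF bounded_linear] \<open>0 \<le> \<rho>\<close> by simp
  then have "N > 0" using N by (cases N) auto
  have "\<exists>r\<ge>0. r \<le> \<rho> \<and> r ^ N * onorm (T ^^ N) = 1"
    by (rule IVT') (use \<open>\<not> _ < 1\<close> \<open>N > 0\<close> \<open>0 \<le> \<rho>\<close> in \<open>auto intro!: continuous_intros simp: power_0_left\<close>)
  then obtain r where r: "0 \<le> r" "r \<le> \<rho>" "r ^ N * onorm (T ^^ N) = 1" by blast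
  have TN: "T ^^ N = T \<circ> T ^^ (N - 1)" and rN: "r ^ N = r * r ^ (N - 1)"
    using \<open>N > 0\<close> by (cases N; simp)+
  have "norm (real N *\<^sub>R r ^ N *\<^sub>R (T ^^ N) x) \<le> 4 * \<rho> * onorm T * M\<^sup>2 * norm x" for x
  proof -
    have "norm (real N *\<^sub>R r ^ N *\<^sub>R (T ^^ N) x) = real N * (r ^ N * norm ((T ^^ N) x))"
      using r(1) by simp
    also have "\<dots> \<le> real N * (r ^ N * (onorm T * norm ((T ^^ (N - 1)) x)))"
      using onorm[OF bounded_linear, of "(T ^^ (N - 1)) x"] r(1)
      unfolding TN by (intro mult_left_mono) auto
    also have "\<dots> = r * onorm T * (real N * (r ^ (N - 1) * norm ((T ^^ (N - 1)) x)))"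
      unfolding rN by (simp add: mult_ac)
    also have "\<dots> \<le> r * onorm T * (M\<^sup>2 * (1 + r ^ N * onorm (T ^^ N))\<^sup>2 * norm x)"
      using r \<open>0 \<le> M\<close> \<open>N > 0\<close> onorm_pos_le[OF bounded_linear] M
      by (intro mult_left_mono power_estimate) auto
    also have "\<dots> = r * (4 * onorm T * M\<^sup>2 * norm x)"
      unfolding r(3) by simp
    also have "\<dots> \<le> \<rho> * (4 * onorm T * M\<^sup>2 * norm x)"
      using r onorm_pos_le[OF bounded_linear] by (intro mult_right_mono) auto
    finally show ?thesis by (simp add: mult_ac)
  qed
  then have "onorm (\<lambda>x. real N *\<^sub>R r ^ N *\<^sub>R (T ^^ N) x) \<le> 4 * \<rho> * onorm T * M\<^sup>2"
    using \<open>0 \<le> 4 * \<rho> * onorm T * M\<^sup>2\<close> by (intro onorm_bound)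
  then have "real N * (r ^ N * onorm (T ^^ N)) \<le> 4 * \<rho> * onorm T * M\<^sup>2"
    using r(1) bounded_linear_funpow
    by (simp add: onorm_scaleR bounded_linear_const_scaleR)
  with r(3) N show False by simp
qed

end


section \<open>Compact operators without eigenvectors\<close>

lemma compact_operator_bounded_clinear:
  assumes "compact_operator T"
  shows "bounded_clinear T"
proof (rule bounded_clinear.intro)
  show lin: "Vector_Spaces.linear scaleC scaleC T"
    using assms by (simp add: compact_operator_def)
  note hom = lin[unfolded Vector_Spaces.linear_iff_module_hom]
  have real_linear: "linear T"
  proof (rule linearI)
    fix x y :: 'a and r :: real
    show "T (x + y) = T x + T y" by (rule module_hom.add[OF hom])
    show "T (r *\<^sub>R x) = r *\<^sub>R T x"
      using module_hom.scale[OF hom, of "of_real r" x] by (simp add: scaleC_of_real)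
  qed
  have "bounded (T ` cball 0 1)"
    using assms bounded_subset[OF compact_imp_bounded closure_subset]
    by (auto simp: compact_operator_def)
  then obtain K where K: "norm (T x) \<le> K" if "norm x \<le> 1" for x
    by (fastforce simp: bounded_iff)
  have "norm (T x) \<le> norm x * K" for x
  proof (cases "x = 0")
    case False
    then have "norm (T (x /\<^sub>R norm x)) \<le> K" by (intro K) simp
    with False show ?thesis
      by (simp add: linear_scale[OF real_linear] field_simps)
  qed (simp add: linear_0[OF real_linear])
  then show "bounded_linear T"
    by (intro bounded_linear_intro[of _ K] linear_add[OF real_linear]
      linear_scale[OF real_linear])
qed

text \<open>If no \<open>M\<close> works, there are unit vectors \<open>u\<^sub>n\<close> and \<open>z\<^sub>n\<close> in the disc with
  \<open>u\<^sub>n - z\<^sub>n T u\<^sub>n\<close> tending to \<open>0\<close>. Along a subsequence \<open>z\<^sub>n\<close> converges to some \<open>c\<close> and, by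
  compactness, \<open>T u\<^sub>n\<close> converges to some \<open>y\<close>. Hence \<open>u\<^sub>n\<close> itself converges to \<open>c y\<close>, a unit vector
  with \<open>T (c y) = y\<close>, which is an eigenvector.\<close>

lemma uniform_lower_bound:
  fixes T :: "'a::complex_normed_vector \<Rightarrow> 'a"
  assumes comp: "compact_operator T"
    and no_eigen: "\<And>c x. T x = c *\<^sub>C x \<Longrightarrow> x = 0"
  shows "\<exists>M\<ge>0. \<forall>z x. cmod z \<le> \<rho> \<longrightarrow> norm x \<le> M * norm (x - z *\<^sub>C T x)"
proof (rule ccontr)
  interpret bounded_clinear T by (rule compact_operator_bounded_clinear[OF comp])
  assume *: "\<not> ?thesis"
  have "\<exists>z u. cmod z \<le> \<rho> \<and> norm u = 1 \<and> norm (u - z *\<^sub>C T u) < 1 / Suc n" for n :: nat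
  proof -
    obtain z x where zx: "cmod z \<le> \<rho>" "\<not> norm x \<le> Suc n * norm (x - z *\<^sub>C T x)"
      using * by (metis of_nat_0_le_iff)
    then have x: "x \<noteq> 0" by auto
    define a where "a = complex_of_real (inverse (norm x))"
    have a: "cmod a = inverse (norm x)" using x by (simp add: a_def norm_inverse)
    have "a *\<^sub>C x - z *\<^sub>C T (a *\<^sub>C x) = a *\<^sub>C (x - z *\<^sub>C T x)"
      by (simp add: scaleC scaleC_scaleC complex_vector.scale_right_diff_distrib mult.commute)
    then have "norm (a *\<^sub>C x - z *\<^sub>C T (a *\<^sub>C x)) = norm (x - z *\<^sub>C T x) / norm x"
      by (simp only: norm_scaleC a) (simp add: divide_inverse mult.commute)
    also have "\<dots> < 1 / Suc n"
      using zx x by (simp add: field_simps)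
    finally have "norm (a *\<^sub>C x - z *\<^sub>C T (a *\<^sub>C x)) < 1 / Suc n" .
    moreover have "norm (a *\<^sub>C x) = 1" using x by (simp add: norm_scaleC a)
    ultimately show ?thesis using zx(1) by blast
  qed
  then obtain z u where zu: "\<And>n. cmod (z n) \<le> \<rho>" "\<And>n. norm (u n) = 1"
      "\<And>n. norm (u n - z n *\<^sub>C T (u n)) < 1 / Suc n"
    by metis
  let ?K = "cball (0::complex) \<rho> \<times> closure (T ` cball 0 1)"
  have K: "compact ?K"
  proof (rule compact_Times)
    show "compact (closure (T ` cball 0 1))"
      using comp bounded_cball unfolding compact_operator_def by blast
  qed (rule compact_cball)
  have zTu: "(z n, T (u n)) \<in> ?K" for n
  proof (rule SigmaI)
    show "T (u n) \<in> closure (T ` cball 0 1)"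
      by (intro subsetD[OF closure_subset] imageI) (simp add: zu(2))
  qed (simp add: zu(1))
  obtain l s where s: "strict_mono s" "((\<lambda>n. (z n, T (u n))) \<circ> s) \<longlonglongrightarrow> l"
    by (rule seq_compactE[OF compact_imp_seq_compact[OF K], of "\<lambda>n. (z n, T (u n))"])
      (use zTu in simp_all)
  obtain c y where l: "l = (c, y)" by (cases l)
  have c: "(\<lambda>n. z (s n)) \<longlonglongrightarrow> c" and y: "(\<lambda>n. T (u (s n))) \<longlonglongrightarrow> y"
    using tendsto_fst[OF s(2)] tendsto_snd[OF s(2)] by (simp_all add: l o_def)
  have "(\<lambda>n. u n - z n *\<^sub>C T (u n)) \<longlonglongrightarrow> 0"
    by (rule Lim_null_comparison[OF _ LIMSEQ_Suc[OF lim_1_over_n]])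
      (use zu(3) in \<open>auto intro!: always_eventually less_imp_le\<close>)
  from LIMSEQ_subseq_LIMSEQ[OF this s(1)]
  have "(\<lambda>n. u (s n) - z (s n) *\<^sub>C T (u (s n)) + z (s n) *\<^sub>C T (u (s n))) \<longlonglongrightarrow> 0 + c *\<^sub>C y"
    by (intro tendsto_add tendsto_scaleC c y) (simp add: o_def)
  then have u: "(\<lambda>n. u (s n)) \<longlonglongrightarrow> c *\<^sub>C y" by simp
  have "norm (c *\<^sub>C y) = 1"
    using tendsto_norm[OF u] by (simp add: zu(2) LIMSEQ_const_iff)
  moreover have "T (c *\<^sub>C y) = y"
    using bounded_linear.tendsto[OF bounded_linear u] y by (rule LIMSEQ_unique)
  ultimately have "T (c *\<^sub>C y) = inverse c *\<^sub>C (c *\<^sub>C y)" "c *\<^sub>C y \<noteq> 0"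
    by (cases "c = 0"; auto simp: scaleC_scaleC scaleC_one)+
  then show False using no_eigen by blast
qed


section \<open>Invariant subspaces\<close>

definition has_invariant_subspace :: "('a::complex_normed_vector \<Rightarrow> 'a) \<Rightarrow> bool"
  where "has_invariant_subspace T \<longleftrightarrow>
    (\<exists>Y. closed Y \<and> complex_vector.subspace Y \<and> {0} \<subset> Y \<and> Y \<subset> UNIV \<and> T ` Y \<subseteq> Y)"

context bounded_clinear
begin

lemma eigenvector_invariant_subspace:
  assumes "complex_dim_gt_1 TYPE('a)" and "T x = c *\<^sub>C x" and "x \<noteq> 0"
  shows "has_invariant_subspace T"
  unfolding has_invariant_subspace_def
proof (intro exI conjI)
  let ?Y = "range (\<lambda>c. c *\<^sub>C x)"
  show "closed ?Y" by (rule closed_complex_line)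
  show sub: "complex_vector.subspace ?Y"
    unfolding complex_vector.span_singleton[symmetric] by (rule complex_vector.subspace_span)
  have "x \<in> ?Y" by (metis rangeI scaleC_one)
  then show "{0} \<subset> ?Y"
    using complex_vector.subspace_0[OF sub] \<open>x \<noteq> 0\<close> by auto
  show "?Y \<subset> UNIV" using complex_line_neq_UNIV[OF assms(1)] by auto
  show "T ` ?Y \<subseteq> ?Y" by (auto simp: scaleC assms(2) scaleC_scaleC)
qed

text \<open>The closure of the orbit is a closed invariant subspace, and it contains \<open>y \<noteq> 0\<close>.\<close>

lemma dense_orbit:
  assumes "\<not> has_invariant_subspace T" and "y \<noteq> 0"
  shows "closure (range (\<lambda>p. poly_op p y)) = UNIV"
proof (rule ccontr)
  let ?O = "range (\<lambda>p. poly_op p y)"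
  assume ne: "closure ?O \<noteq> UNIV"
  have "complex_vector.subspace (closure ?O)"
  proof (rule complex_vector.subspaceI)
    show "0 \<in> closure ?O"
      using closure_subset[of ?O] poly_op_0[of y] by (metis rangeI subsetD)
  next
    fix a b assume "a \<in> closure ?O" "b \<in> closure ?O"
    then obtain f g where fg: "\<And>n. f n \<in> ?O" "\<And>n. g n \<in> ?O" "f \<longlonglongrightarrow> a" "g \<longlonglongrightarrow> b"
      unfolding closure_sequential by metis
    have "f n + g n \<in> ?O" for n
      using fg(1,2)[of n] by (auto simp: poly_op_add[symmetric])
    then show "a + b \<in> closure ?O"
      unfolding closure_sequential
      by (intro exI[of _ "\<lambda>n. f n + g n"] conjI allI tendsto_add[OF fg(3,4)])
  next
    fix c a assume "a \<in> closure ?O"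
    then obtain f where f: "\<And>n. f n \<in> ?O" "f \<longlonglongrightarrow> a"
      unfolding closure_sequential by metis
    have "c *\<^sub>C f n \<in> ?O" for n
      using f(1)[of n] by (auto simp: poly_op_smult[symmetric])
    then show "c *\<^sub>C a \<in> closure ?O"
      unfolding closure_sequential
      by (intro exI[of _ "\<lambda>n. c *\<^sub>C f n"] conjI allI tendsto_scaleC[OF tendsto_const f(2)])
  qed
  moreover have "T ` closure ?O \<subseteq> closure ?O"
  proof -
    have "T (poly_op p y) = poly_op (pCons 0 p) y" for p
      by (simp add: poly_op_pCons)
    then have "T ` ?O \<subseteq> closure ?O"
      using closure_subset[of ?O] by auto
    then show ?thesis
      by (intro image_closure_subset linear_continuous_on bounded_linear) auto
  qed
  moreover have "y \<in> closure ?O"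
    using closure_subset[of ?O] poly_op_1[of y] by (metis rangeI subsetD)
  ultimately have "has_invariant_subspace T"
    unfolding has_invariant_subspace_def using ne \<open>y \<noteq> 0\<close> complex_vector.subspace_0
    by (intro exI[of _ "closure ?O"]) auto
  with assms(1) show False by simp
qed

text \<open>Follow \<open>x\<close> around: apply \<open>T\<close>, return to \<open>B\<close> by some \<open>p \<in> F\<close>, apply \<open>T\<close> again, and so on.
  Since everything commutes, the \<open>n\<close> applications of \<open>T\<close> can be moved to the front, leaving a vector
  \<open>v\<close> obtained from \<open>x\<close> by \<open>n\<close> polynomials from \<open>F\<close>. The induction carries this product as one
  polynomial \<open>q\<close>, because the next factor has to be moved past the powers of \<open>T\<close>.\<close>

lemma iterated_return:
  assumes F: "\<And>x. x \<in> B \<Longrightarrow> \<exists>p\<in>F. poly_op p (T x) \<in> B"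
    and C: "\<And>p x. p \<in> F \<Longrightarrow> norm (poly_op p x) \<le> C * norm x" and "0 \<le> C"
    and "x \<in> B"
  shows "\<exists>v. norm v \<le> C ^ n * norm x \<and> (T ^^ n) v \<in> B"
proof -
  have "\<exists>q. (\<forall>u. norm (poly_op q u) \<le> C ^ n * norm u) \<and> poly_op ([:0, 1:] ^ n * q) x \<in> B"
  proof (induction n)
    case 0
    show ?case by (rule exI[of _ 1]) (use \<open>x \<in> B\<close> in simp)
  next
    case (Suc n)
    then obtain q where q: "\<And>u. norm (poly_op q u) \<le> C ^ n * norm u"
        "poly_op ([:0, 1:] ^ n * q) x \<in> B" by blast
    from F[OF q(2)] obtain p where p: "p \<in> F" "poly_op p (T (poly_op ([:0, 1:] ^ n * q) x)) \<in> B"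
      by blast
    have "poly_op ([:0, 1:] ^ Suc n * (p * q)) x = poly_op (p * ([:0, 1:] * ([:0, 1:] ^ n * q))) x"
      by (simp only: power_Suc mult_ac)
    also have "\<dots> = poly_op p (T (poly_op ([:0, 1:] ^ n * q) x))"
      by (simp add: poly_op_mult poly_op_pCons zero scaleC_one del: mult_pCons_left)
    finally have "poly_op ([:0, 1:] ^ Suc n * (p * q)) x \<in> B" using p(2) by simp
    moreover have "norm (poly_op (p * q) u) \<le> C ^ Suc n * norm u" for u
      using order_trans[OF C[OF p(1), of "poly_op q u"] mult_left_mono[OF q(1) \<open>0 \<le> C\<close>]]
      by (simp add: poly_op_mult mult_ac)
    ultimately show ?case by blast
  qed
  then obtain q where "norm (poly_op q x) \<le> C ^ n * norm x" "poly_op ([:0, 1:] ^ n * q) x \<in> B"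
    by blast
  then show ?thesis
    by (intro exI[of _ "poly_op q x"])
      (simp add: poly_op_mult poly_op_linear_power scaleC_one del: mult_pCons_left)
qed

end

text \<open>The radius of the ball is chosen so small that \<open>T\<close> maps it into the ball of radius
  \<open>\<parallel>T x0\<parallel> / 2\<close> around \<open>T x0\<close>; then
  \<open>closure (T ` B)\<close> avoids \<open>0\<close>, and so does \<open>B\<close> because \<open>T 0 = 0\<close>. Every point of this compact set
  has a dense orbit and hence lies in an open set of points sent into the interior of \<open>B\<close> by a
  single polynomial. Finitely many of these sets cover it.\<close>

lemma compact_operator_finite_return:
  fixes T :: "'a::complex_normed_vector \<Rightarrow> 'a"
  assumes comp: "compact_operator T" and none: "\<not> has_invariant_subspace T" and "T \<noteq> (\<lambda>_. 0)"
  obtains x0 \<epsilon> F where "0 \<notin> cball x0 \<epsilon>" "0 < \<epsilon>" "finite F"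
    "\<And>x. x \<in> cball x0 \<epsilon> \<Longrightarrow> \<exists>p\<in>F. bounded_clinear.poly_op T p (T x) \<in> cball x0 \<epsilon>"
proof -
  interpret bounded_clinear T by (rule compact_operator_bounded_clinear[OF comp])
  obtain x0 where x0: "T x0 \<noteq> 0" using \<open>T \<noteq> (\<lambda>_. 0)\<close> by auto
  then have "onorm T > 0"
    using onorm_pos_lt[OF bounded_linear] by blast
  define \<epsilon> where "\<epsilon> = norm (T x0) / (2 * onorm T)"
  have "\<epsilon> > 0" using x0 \<open>onorm T > 0\<close> by (simp add: \<epsilon>_def)
  define B where "B = cball x0 \<epsilon>"
  define K where "K = closure (T ` B)"
  have far: "norm (T x) \<ge> norm (T x0) / 2" if "x \<in> B" for x
  proof -
    have "norm (T x0) - norm (T x) \<le> norm (T (x0 - x))"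
      by (simp add: diff norm_triangle_ineq2)
    also have "\<dots> \<le> onorm T * norm (x0 - x)"
      by (rule onorm[OF bounded_linear])
    also have "\<dots> \<le> onorm T * \<epsilon>"
      using that \<open>onorm T > 0\<close> by (intro mult_left_mono) (auto simp: B_def dist_norm)
    also have "\<dots> = norm (T x0) / 2"
      using \<open>onorm T > 0\<close> by (simp add: \<epsilon>_def)
    finally show ?thesis by simp
  qed
  have "0 \<notin> B" using far[of 0] x0 by (auto simp: zero)
  have "K \<subseteq> {y. norm (T x0) / 2 \<le> norm y}"
    unfolding K_def by (rule closure_minimal)
      (use far in \<open>auto intro!: closed_Collect_le continuous_intros\<close>)
  then have K0: "y \<noteq> 0" if "y \<in> K" for y using that x0 by auto
  have "compact K"
    using comp unfolding K_def B_def compact_operator_def by blast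
  define U where "U p = poly_op p -` ball x0 \<epsilon>" for p
  have "open (U p)" for p
    unfolding U_def
    by (intro open_vimage open_ball linear_continuous_on bounded_linear_poly_op)
  moreover have "K \<subseteq> (\<Union>p\<in>UNIV. U p)"
  proof
    fix y assume "y \<in> K"
    then have "x0 \<in> closure (range (\<lambda>p. poly_op p y))"
      using dense_orbit[OF none K0] by simp
    then obtain p where "dist (poly_op p y) x0 < \<epsilon>"
      using \<open>\<epsilon> > 0\<close> by (auto simp: closure_approachable)
    then show "y \<in> (\<Union>p\<in>UNIV. U p)" by (auto simp: U_def dist_commute)
  qed
  ultimately obtain F where F: "finite F" "K \<subseteq> (\<Union>p\<in>F. U p)"
    using compactE_image[OF \<open>compact K\<close>, of UNIV U] by metis
  have return: "\<exists>p\<in>F. poly_op p (T x) \<in> B" if "x \<in> B" for x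
  proof -
    have "T x \<in> K" using that closure_subset[of "T ` B"] by (auto simp: K_def)
    then show ?thesis using F(2) by (force simp: U_def B_def)
  qed
  show ?thesis
    by (rule that[of x0 \<epsilon> F]) (use return \<open>0 \<notin> B\<close> \<open>\<epsilon> > 0\<close> F(1) in \<open>auto simp: B_def\<close>)
qed

text \<open>The growth estimate is applied on the disc of radius \<open>2 C\<close>, where \<open>C\<close> bounds the returning
  polynomials. The factor \<open>2\<close> turns boundedness of \<open>(2 C)\<^sup>n \<parallel>T\<^sup>n\<parallel>\<close> into \<open>C\<^sup>n \<parallel>T\<^sup>n\<parallel> \<le> 2\<^sup>-\<^sup>n\<close>.\<close>

lemma compact_operator_invariant_subspace:
  fixes T :: "'a::complex_normed_vector \<Rightarrow> 'a"
  assumes dim: "complex_dim_gt_1 TYPE('a)" and comp: "compact_operator T"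
  shows "has_invariant_subspace T"
proof (rule ccontr)
  interpret bounded_clinear T by (rule compact_operator_bounded_clinear[OF comp])
  assume none: "\<not> has_invariant_subspace T"
  then have no_eigen: "x = 0" if "T x = c *\<^sub>C x" for c x
    using eigenvector_invariant_subspace[OF dim that] by blast
  obtain e :: 'a where "e \<noteq> 0"
    using complex_line_neq_UNIV[OF dim, of 0] by auto
  then have "T \<noteq> (\<lambda>_. 0)" using no_eigen[of e 0] by auto
  then obtain x0 \<epsilon> F where B: "0 \<notin> cball x0 \<epsilon>" "0 < \<epsilon>" "finite F"
      "\<And>x. x \<in> cball x0 \<epsilon> \<Longrightarrow> \<exists>p\<in>F. poly_op p (T x) \<in> cball x0 \<epsilon>"
    using compact_operator_finite_return[OF comp none] by metis
  define C where "C = 1 + (\<Sum>p\<in>F. onorm (poly_op p))"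
  have pos: "0 \<le> onorm (poly_op p)" for p
    by (rule onorm_pos_le[OF bounded_linear_poly_op])
  have "C \<ge> 1" unfolding C_def by (simp add: sum_nonneg pos)
  have C: "norm (poly_op p x) \<le> C * norm x" if "p \<in> F" for p x
  proof -
    have "onorm (poly_op p) \<le> (\<Sum>p\<in>F. onorm (poly_op p))"
      using that B(3) pos by (intro member_le_sum) auto
    then have "onorm (poly_op p) * norm x \<le> C * norm x"
      by (intro mult_right_mono) (auto simp: C_def)
    with onorm[OF bounded_linear_poly_op, of p x] show ?thesis by linarith
  qed
  have "\<exists>M\<ge>0. \<forall>z x. cmod z \<le> 2 * C \<longrightarrow> norm x \<le> M * norm (x - z *\<^sub>C T x)"
    by (rule uniform_lower_bound[OF comp]) (rule no_eigen)
  then obtain M where M: "M \<ge> 0" "\<And>z x. cmod z \<le> 2 * C \<Longrightarrow> norm x \<le> M * norm (x - z *\<^sub>C T x)"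
    by blast
  define \<delta> where "\<delta> = norm x0 - \<epsilon>"
  have "\<delta> > 0" using B(1) by (simp add: \<delta>_def)
  have far: "norm x \<ge> \<delta>" if "x \<in> cball x0 \<epsilon>" for x
    using that norm_triangle_ineq2[of x0 x] by (simp add: \<delta>_def dist_norm)
  obtain n1 where n1: "(1 / 2) ^ n1 < \<delta> / norm x0"
    using real_arch_pow_inv[of "\<delta> / norm x0" "1/2"] \<open>\<delta> > 0\<close> B(1,2) by (cases "x0 = 0") auto
  obtain n2 :: nat where n2: "4 * (2 * C) * onorm T * M\<^sup>2 < n2"
    using reals_Archimedean2 by blast
  define n where "n = max n1 n2"
  have "(2 * C) ^ n * onorm (T ^^ n) < 1"
    by (rule onorm_funpow_small[of _ M])
      (use M \<open>C \<ge> 1\<close> n2 in \<open>auto simp: n_def\<close>)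
  then have small: "C ^ n * onorm (T ^^ n) \<le> (1 / 2) ^ n"
    by (simp add: power_mult_distrib field_simps)
  obtain v where v: "norm v \<le> C ^ n * norm x0" "(T ^^ n) v \<in> cball x0 \<epsilon>"
    using iterated_return[OF B(4) C, of x0 n] \<open>C \<ge> 1\<close> B(2) by auto
  have "\<delta> \<le> norm ((T ^^ n) v)" by (rule far[OF v(2)])
  also have "\<dots> \<le> onorm (T ^^ n) * norm v" by (rule onorm[OF bounded_linear_funpow])
  also have "\<dots> \<le> onorm (T ^^ n) * (C ^ n * norm x0)"
    by (intro mult_left_mono v onorm_pos_le bounded_linear_funpow)
  also have "\<dots> = (C ^ n * onorm (T ^^ n)) * norm x0" by simp
  also have "\<dots> \<le> (1 / 2) ^ n * norm x0"
    by (intro mult_right_mono small) simp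
  also have "\<dots> \<le> (1 / 2) ^ n1 * norm x0"
    by (intro mult_right_mono power_decreasing) (auto simp: n_def)
  also have "\<dots> < \<delta>"
    using n1 B(1,2) by (cases "x0 = 0") (auto simp: field_simps)
  finally show False by simp
qed

theorem theorem3p2:
  fixes T :: "'a::complex_banach \<Rightarrow> 'a"
  assumes "reflexive_space TYPE('a)"
    and "complex_dim_gt_1 TYPE('a)"
    and "compact_operator T"
  shows "\<exists>Y::'a set. closed Y \<and> complex_vector.subspace Y \<and>
    {0} \<subset> Y \<and> Y \<subset> UNIV \<and> T ` Y \<subseteq> Y"
  using compact_operator_invariant_subspace[OF assms(2,3)]
  unfolding has_invariant_subspace_def .

end
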